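(* For every $\delta\in[0,1]$ there exist a tropical rational function $f$ and a constant $a\in\mathbb{R}$ such that $\delta(a,f)=\delta$.
   Context: $a\oplus b=\max\{a,b\}$, $1_\circ=0$, $a\oslash b=a-b$, so $1_\circ\oslash(f\oplus a)=-\max\{f,a\}$; $t^+=\max\{t,0\}$. A tropical meromorphic function is a continuous piecewise linear $f:\mathbb{R}\to\mathbb{R}$ (finitely many affine pieces on each bounded interval); with $\omega_f(x)=\lim_{\varepsilon\to0^+}(f'(x+\varepsilon)-f'(x-\varepsilon))$, $x$ is a root if $\omega_f(x)>0$, a pole if $\omega_f(x)<0$, of multiplicity $\tau_f(x)=|\omega_f(x)|$. It is tropical rational if it has only finitely many roots and poles. $m(r,f)=\frac12(f(r)^++f(-r)^+)$, $N(r,f)=\frac12\sum_{|b|<r}\tau_f(b)(r-|b|)$ over the poles $b$ of $f$ in $(-r,r)$, $T(r,f)=m(r,f)+N(r,f)$. The defect is $$\delta(a,f)=1-\limsup_{r\to\infty}\frac{N\big(r,1_\circ\oslash(f\oplus a)\big)}{T(r,f)}.$$ *)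

theory Defs
  imports "HOL-Analysis.Analysis"
begin

definition trop_add :: "real \<Rightarrow> real \<Rightarrow> real" (infixl "\<oplus>" 65) where
  "a \<oplus> b = max a b"

definition trop_one :: real ("1\<^sub>\<circ>") where
  "1\<^sub>\<circ> = 0"

definition trop_div :: "real \<Rightarrow> real \<Rightarrow> real" (infixl "\<oslash>" 70) where
  "a \<oslash> b = a - b"

definition pos_part :: "real \<Rightarrow> real" where
  "pos_part t = max t 0"

text \<open>The pieces may be degenerate, overlapping, open or closed; since \<open>f\<close> is continuous this
  does not matter. Slopes are arbitrary real numbers.\<close>

definition tropical_meromorphic :: "(real \<Rightarrow> real) \<Rightarrow> bool" where
  "tropical_meromorphic f \<longleftrightarrow>
     continuous_on UNIV f \<and>
     (\<forall>a b. \<exists>P. finite P \<and> \<Union>P = {a..b} \<and>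
        (\<forall>I\<in>P. is_interval I \<and> (\<exists>m c. \<forall>x\<in>I. f x = m * x + c)))"

definition omega :: "(real \<Rightarrow> real) \<Rightarrow> real \<Rightarrow> real" where
  "omega f x = Lim (at_right 0) (\<lambda>\<epsilon>. deriv f (x + \<epsilon>) - deriv f (x - \<epsilon>))"

definition trop_roots :: "(real \<Rightarrow> real) \<Rightarrow> real set" where
  "trop_roots f = {x. omega f x > 0}"

definition trop_poles :: "(real \<Rightarrow> real) \<Rightarrow> real set" where
  "trop_poles f = {x. omega f x < 0}"

definition trop_mult :: "(real \<Rightarrow> real) \<Rightarrow> real \<Rightarrow> real" where
  "trop_mult f x = \<bar>omega f x\<bar>"

definition tropical_rational :: "(real \<Rightarrow> real) \<Rightarrow> bool" where
  "tropical_rational f \<longleftrightarrow>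
     tropical_meromorphic f \<and> finite (trop_roots f) \<and> finite (trop_poles f)"

definition proximity :: "real \<Rightarrow> (real \<Rightarrow> real) \<Rightarrow> real" where
  "proximity r f = (pos_part (f r) + pos_part (f (- r))) / 2"

definition counting :: "real \<Rightarrow> (real \<Rightarrow> real) \<Rightarrow> real" where
  "counting r f = (\<Sum>b\<in>{b\<in>trop_poles f. \<bar>b\<bar> < r}. trop_mult f b * (r - \<bar>b\<bar>)) / 2"

definition characteristic :: "real \<Rightarrow> (real \<Rightarrow> real) \<Rightarrow> real" where
  "characteristic r f = proximity r f + counting r f"

text \<open>The upper limit is taken in the extended reals, where it always exists. The quotient is the
  intended one only if \<open>characteristic r f\<close> is nonzero for all large \<open>r\<close>, because of the
  convention \<open>x / 0 = 0\<close>.\<close>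

definition defect :: "real \<Rightarrow> (real \<Rightarrow> real) \<Rightarrow> ereal" where
  "defect a f =
     1 - Limsup at_top (\<lambda>r. ereal (counting r (\<lambda>x. 1\<^sub>\<circ> \<oslash> (f x \<oplus> a)) / characteristic r f))"

end

theory Submission
  imports Defs
begin

text \<open>Take \<open>a = 0\<close> and let \<open>f\<close> have slope \<open>1\<close> on the negative and slope \<open>1 - \<delta>\<close> on the positive
  half-line, with \<open>f 0 = 0\<close>. Its only possible pole is the origin, of multiplicity \<open>\<delta>\<close>, so that
  \<open>T(r, f) = (1 - \<delta>) r / 2 + \<delta> r / 2 = r / 2\<close>. The function \<open>- max f 0\<close> has slopes \<open>0\<close> and
  \<open>- (1 - \<delta>)\<close>, so its counting function is \<open>(1 - \<delta>) r / 2\<close>.\<close>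

text \<open>Both \<open>f\<close> and \<open>- max f 0\<close> lie in this family, so one
  computation of \<open>omega\<close> and of \<open>counting\<close> serves numerator and
  denominator of the defect.\<close>

definition two_slope :: "real \<Rightarrow> real \<Rightarrow> real \<Rightarrow> real" where
  "two_slope p q x = (if x \<le> 0 then p * x else q * x)"

lemma deriv_two_slope_neg:
  assumes "x < 0"
  shows "deriv (two_slope p q) x = p"
proof (rule DERIV_imp_deriv)
  have "((\<lambda>y. p * y) has_field_derivative p) (at x)"
    by (auto intro!: derivative_eq_intros)
  moreover have "open {..<0::real}" "x \<in> {..<0::real}" using assms by simp_all
  ultimately show "(two_slope p q has_field_derivative p) (at x)"
    by (rule has_field_derivative_transform_within_open) (auto simp: two_slope_def)
qed

lemma deriv_two_slope_pos:
  assumes "0 < x"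
  shows "deriv (two_slope p q) x = q"
proof (rule DERIV_imp_deriv)
  have "((\<lambda>y. q * y) has_field_derivative q) (at x)"
    by (auto intro!: derivative_eq_intros)
  moreover have "open {0::real<..}" "x \<in> {0::real<..}" using assms by simp_all
  ultimately show "(two_slope p q has_field_derivative q) (at x)"
    by (rule has_field_derivative_transform_within_open) (auto simp: two_slope_def)
qed

lemma omega_eqI:
  assumes "\<forall>\<^sub>F \<epsilon> in at_right 0. deriv f (x + \<epsilon>) - deriv f (x - \<epsilon>) = c"
  shows "omega f x = c"
  unfolding omega_def using assms by (intro tendsto_Lim tendsto_eventually) auto

lemma omega_two_slope: "omega (two_slope p q) x = (if x = 0 then q - p else 0)"
proof (rule omega_eqI)
  \<comment> \<open>For \<open>x \<noteq> 0\<close> the bound keeps both sample points on the same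
    side of the origin as \<open>x\<close>; for \<open>x = 0\<close> the bound 1 is arbitrary.
    Either way the derivative at the kink is never evaluated.\<close>
  have "\<forall>\<^sub>F \<epsilon> in at_right 0. \<epsilon> \<in> {0<..<if x = 0 then 1 else \<bar>x\<bar>}"
    by (rule eventually_at_right_real) auto
  then show "\<forall>\<^sub>F \<epsilon> in at_right 0.
      deriv (two_slope p q) (x + \<epsilon>) - deriv (two_slope p q) (x - \<epsilon>) =
      (if x = 0 then q - p else 0)"
  proof eventually_elim
    case (elim \<epsilon>)
    consider "x = 0" | "x < 0" "x + \<epsilon> < 0" "x - \<epsilon> < 0" | "x > 0" "x + \<epsilon> > 0" "x - \<epsilon> > 0"
      using elim by (cases "x = 0"; cases "x < 0") auto
    then show ?case
      using elim by cases (auto simp: deriv_two_slope_neg deriv_two_slope_pos)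
  qed
qed

lemma tropical_rational_two_slope: "tropical_rational (two_slope p q)"
proof -
  \<comment> \<open>Writing the function through \<open>min\<close> and \<open>max\<close> removes
    the case distinction, so that continuity at the origin is automatic.\<close>
  have "continuous_on UNIV (\<lambda>x. p * min x 0 + q * max x 0)"
    by (intro continuous_intros)
  moreover have "(\<lambda>x. p * min x 0 + q * max x 0) = two_slope p q"
    by (auto simp: two_slope_def fun_eq_iff)
  ultimately have "continuous_on UNIV (two_slope p q)"
    by (simp only:)
  moreover have "\<exists>P. finite P \<and> \<Union>P = {a..b} \<and>
      (\<forall>I\<in>P. is_interval I \<and> (\<exists>m c. \<forall>x\<in>I. two_slope p q x = m * x + c))" for a b
  proof (intro exI[of _ "{{a..b} \<inter> {..0}, {a..b} \<inter> {0<..}}"] conjI ballI)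
    fix I assume I: "I \<in> {{a..b} \<inter> {..0}, {a..b} \<inter> {0<..}}"
    then show "is_interval I"
      by (auto intro!: is_interval_Int is_interval_cc is_interval_ic is_interval_oi)
    from I show "\<exists>m c. \<forall>x\<in>I. two_slope p q x = m * x + c"
      by (auto simp: two_slope_def intro: exI[of _ p] exI[of _ q] exI[of _ 0])
  qed auto
  moreover have "trop_roots (two_slope p q) \<subseteq> {0}" "trop_poles (two_slope p q) \<subseteq> {0}"
    by (auto simp: trop_roots_def trop_poles_def omega_two_slope split: if_splits)
  ultimately show ?thesis
    unfolding tropical_rational_def tropical_meromorphic_def
    by (auto intro: finite_subset)
qed

lemma counting_two_slope:
  assumes "0 < r" and "q \<le> p"
  shows "counting r (two_slope p q) = (p - q) * r / 2"
\<comment> \<open>For \<open>q = p\<close> there is no kink, so the sum runs over the empty set; for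
  \<open>q < p\<close> the jump \<open>q - p\<close> is negative and makes the origin the only
  pole.\<close>
proof (cases "q = p")
  case True
  then show ?thesis
    by (simp add: counting_def trop_poles_def omega_two_slope)
next
  case False
  with assms have "{b \<in> trop_poles (two_slope p q). \<bar>b\<bar> < r} = {0}"
    by (auto simp: trop_poles_def omega_two_slope split: if_splits)
  with assms show ?thesis
    by (simp add: counting_def trop_mult_def omega_two_slope)
qed

theorem theorem4p1:
  fixes \<delta> :: real
  assumes "0 \<le> \<delta>" and "\<delta> \<le> 1"
  shows "\<exists>(f :: real \<Rightarrow> real) (a :: real).
           tropical_rational f \<and>
           (\<forall>\<^sub>F r in at_top. characteristic r f > 0) \<and>
           defect a f = ereal \<delta>"
proof (intro exI conjI)
  define f where "f = two_slope 1 (1 - \<delta>)"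
  show "tropical_rational f"
    by (simp add: f_def tropical_rational_two_slope)
  \<comment> \<open>The proximity comes from \<open>f r\<close> alone, since
    \<open>f (- r) = - r\<close> has positive part 0.\<close>
  have T: "characteristic r f = r / 2" if "0 < r" for r
    using that assms counting_two_slope[OF that, of "1 - \<delta>" 1]
    by (simp add: f_def characteristic_def proximity_def pos_part_def two_slope_def field_simps)
  show "\<forall>\<^sub>F r in at_top. characteristic r f > 0"
    using eventually_gt_at_top[of 0] by eventually_elim (simp add: T)
  \<comment> \<open>The maximum is 0 on the left, where \<open>f x = x\<close>, and
    \<open>f x\<close> on the right, where \<delta> \<le> 1 gives
    \<open>f x \<ge> 0\<close>.\<close>
  have "(\<lambda>x. 1\<^sub>\<circ> \<oslash> (f x \<oplus> 0)) = two_slope 0 (- (1 - \<delta>))"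
    using assms
    by (auto simp: fun_eq_iff f_def two_slope_def trop_one_def trop_div_def trop_add_def
        max_def mult_le_0_iff algebra_simps)
  then have N: "counting r (\<lambda>x. 1\<^sub>\<circ> \<oslash> (f x \<oplus> 0)) = (1 - \<delta>) * r / 2" if "0 < r" for r
    using that assms by (simp add: counting_two_slope)
  \<comment> \<open>The factor \<open>r / 2\<close> cancels for \<open>r > 0\<close>, so the upper
    limit is that of a constant.\<close>
  have "\<forall>\<^sub>F r in at_top.
      ereal (counting r (\<lambda>x. 1\<^sub>\<circ> \<oslash> (f x \<oplus> 0)) / characteristic r f) = ereal (1 - \<delta>)"
    using eventually_gt_at_top[of 0] by eventually_elim (simp add: T N)
  then have "Limsup at_top (\<lambda>r. ereal (counting r (\<lambda>x. 1\<^sub>\<circ> \<oslash> (f x \<oplus> 0)) / characteristic r f)) =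
      Limsup at_top (\<lambda>r::real. ereal (1 - \<delta>))"
    by (rule Limsup_eq)
  then show "defect 0 f = ereal \<delta>"
    by (simp add: defect_def Limsup_const one_ereal_def)
qed

end
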